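(* Let $(Z,d)$ be a complete metric space with $\operatorname{diam} Z>0$, let $b\in Z$, let $\rho$ be a metric density function and let $\hat d$ be the corresponding deformed metric (see context). (a) (Sphericalization) Assume that $(Z,d)$ is unbounded and uniformly perfect at large scales at $b$, and that $\rho(0)<\infty$. Then $(Z,\hat d)$ is bounded and its completion adds exactly one point (called $\boldsymbol{\infty}$) if and only if \[ \int_1^\infty \rho\,dt<\infty . \] (b) (Flattening) Assume that $(Z,d)$ is bounded and uniformly perfect at $b$. Then $(Z\setminus\{b\},\hat d)$ is unbounded and complete if and only if \[ \int_0^1\rho\,dt=\infty . \]
   Context: Notation: $|x|=d(x,b)$ and $B(x,r)=\{y\in Z:d(x,y)<r\}$. A metric density function is a nonincreasing function $\rho:(0,\infty)\to(0,\infty)$, with $\rho(0)=\lim_{t\to0+}\rho(t)\in(0,\infty]$; for $x\in Z$ write $\rho(x)=\rho(|x|)$. Define \[ \hat d(x,y)=\inf\Bigl\{\sum_{j=1}^n(\rho(x_j)+\rho(x_{j-1}))\,d(x_j,x_{j-1})\Bigr\}, \] the infimum being over all finite chains $x=x_0,x_1,\dots,x_n=y$ of points in $Z$. It is a metric on $Z$ if $\rho(0)<\infty$, and on $Z\setminus\{b\}$ in all cases. $Z$ is uniformly perfect at $b$ if there is $\kappa>1$ such that $B(b,\kappa r)\setminus B(b,r)\neq\emptyset$ whenever $r>0$ and $B(b,r)\neq Z$. $Z$ is uniformly perfect at large scales at $b$ if it is unbounded and there is $\kappa>1$ such that $B(b,\kappa r)\setminus B(b,r)\ne\emptyset$ for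 all $r\ge1$. *)

theory Defs
  imports "HOL-Analysis.Analysis"
begin

text \<open>Spaces are given by a carrier set \<open>Z\<close> and a distance function \<open>d\<close>, as in the
  library locale \<^locale>\<open>Metric_space\<close>. The deformed metric lives on \<open>Z\<close> or on \<open>Z - {b}\<close>,
  so carriers cannot be whole types.\<close>

text \<open>Only the values of \<open>\<rho>\<close> on \<open>(0,\<infinity>)\<close> matter; \<open>\<rho> 0\<close> and the values at negative
  arguments are never used.\<close>

definition metric_density :: "(real \<Rightarrow> real) \<Rightarrow> bool" where
  "metric_density \<rho> \<longleftrightarrow> (\<forall>t>0. 0 < \<rho> t) \<and> (\<forall>s t. 0 < s \<longrightarrow> s \<le> t \<longrightarrow> \<rho> t \<le> \<rho> s)"

text \<open>The value at \<open>0\<close> is the right limit, which may be infinite.\<close>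

definition density_val :: "(real \<Rightarrow> real) \<Rightarrow> real \<Rightarrow> ennreal" where
  "density_val \<rho> t = (if t = 0 then Lim (at_right 0) (\<lambda>s. ennreal (\<rho> s)) else ennreal (\<rho> t))"

definition is_chain :: "'a set \<Rightarrow> 'a \<Rightarrow> 'a \<Rightarrow> nat \<Rightarrow> (nat \<Rightarrow> 'a) \<Rightarrow> bool" where
  "is_chain Z x y n c \<longleftrightarrow> c 0 = x \<and> c n = y \<and> (\<forall>j\<le>n. c j \<in> Z)"

definition chain_length ::
  "('a \<Rightarrow> 'a \<Rightarrow> real) \<Rightarrow> 'a \<Rightarrow> (real \<Rightarrow> real) \<Rightarrow> nat \<Rightarrow> (nat \<Rightarrow> 'a) \<Rightarrow> ennreal" where
  "chain_length d b \<rho> n c =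
     (\<Sum>j=1..n. (density_val \<rho> (d (c j) b) + density_val \<rho> (d (c (j - 1)) b))
                * ennreal (d (c j) (c (j - 1))))"

text \<open>Chains may pass through \<open>b\<close>. If \<open>\<rho>(0) = \<infinity>\<close>, a chain that moves to or from \<open>b\<close> has
  infinite length and does not influence the infimum. The conversion to \<^typ>\<open>real\<close> loses
  nothing on the carriers where the deformed metric is used: the one-step chain from \<open>x\<close> to
  \<open>y\<close> has finite length unless \<open>\<rho>(0) = \<infinity>\<close> and \<open>b \<in> {x, y}\<close>.\<close>

definition deformed_dist ::
  "'a set \<Rightarrow> ('a \<Rightarrow> 'a \<Rightarrow> real) \<Rightarrow> 'a \<Rightarrow> (real \<Rightarrow> real) \<Rightarrow> 'a \<Rightarrow> 'a \<Rightarrow> real" where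
  "deformed_dist Z d b \<rho> x y =
     enn2real (Inf {chain_length d b \<rho> n c | n c. is_chain Z x y n c})"

text \<open>The library has no diameter for carrier-based metric spaces.\<close>

definition mdiam :: "'a set \<Rightarrow> ('a \<Rightarrow> 'a \<Rightarrow> real) \<Rightarrow> ennreal" where
  "mdiam Z d = (SUP (x, y) \<in> Z \<times> Z. ennreal (d x y))"

definition unif_perfect_at :: "'a set \<Rightarrow> ('a \<Rightarrow> 'a \<Rightarrow> real) \<Rightarrow> 'a \<Rightarrow> bool" where
  "unif_perfect_at Z d b \<longleftrightarrow>
     (\<exists>\<kappa>>1. \<forall>r>0. Metric_space.mball Z d b r \<noteq> Z \<longrightarrow>
        Metric_space.mball Z d b (\<kappa> * r) - Metric_space.mball Z d b r \<noteq> {})"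

definition unif_perfect_large_scales_at :: "'a set \<Rightarrow> ('a \<Rightarrow> 'a \<Rightarrow> real) \<Rightarrow> 'a \<Rightarrow> bool" where
  "unif_perfect_large_scales_at Z d b \<longleftrightarrow>
     \<not> Metric_space.mbounded Z d Z \<and>
     (\<exists>\<kappa>>1. \<forall>r\<ge>1.
        Metric_space.mball Z d b (\<kappa> * r) - Metric_space.mball Z d b r \<noteq> {})"

definition is_completion ::
  "'a set \<Rightarrow> ('a \<Rightarrow> 'a \<Rightarrow> real) \<Rightarrow> 'b metric \<Rightarrow> ('a \<Rightarrow> 'b) \<Rightarrow> bool" where
  "is_completion M d m f \<longleftrightarrow>
     mcomplete_of m \<and> f \<in> M \<rightarrow> mspace m \<and>
     (\<forall>x\<in>M. \<forall>y\<in>M. mdist m (f x) (f y) = d x y) \<and>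
     mtopology_of m closure_of (f ` M) = mspace m"

text \<open>Every metric space on a subset of \<^typ>\<open>'a\<close> has a completion inside \<^typ>\<open>'a \<Rightarrow> real\<close>
  (\<open>Metric_space.metric_completion\<close>), and completions are unique up to isometry, so the choice
  of this type and the existential quantifier are harmless.\<close>

definition completion_adds_one_point :: "'a set \<Rightarrow> ('a \<Rightarrow> 'a \<Rightarrow> real) \<Rightarrow> bool" where
  "completion_adds_one_point M d \<longleftrightarrow>
     (\<exists>(m :: ('a \<Rightarrow> real) metric) f. is_completion M d m f \<and> (\<exists>!p. p \<in> mspace m - f ` M))"

end

theory Submission
  imports Defs
begin

text \<open>Write \<open>\<bar>x\<bar> = d x b\<close>. A step of a chain costs at least \<open>\<integral>\<rho>\<close> over the interval between the
  radii of its end points, so the deformed distance of \<open>x\<close> and \<open>y\<close> is at least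
  \<open>\<integral>\<rho>\<close> from \<open>\<bar>x\<bar>\<close> to \<open>\<bar>y\<bar>\<close>. Conversely, where \<open>Z\<close> meets every annulus
  \<open>{w. r \<le> \<bar>w\<bar> < \<kappa> r}\<close>, a chain through annuli with geometrically growing radii shows that the
  distance is at most a constant times \<open>\<integral>\<rho>\<close> over the range of radii, enlarged by the
  factor \<open>\<kappa>\<close> at its lower end. So convergence of the integral means that all points far away
  (or close to \<open>b\<close>) merge into one limit point, and divergence that they are infinitely far. On
  balls around \<open>b\<close> the density is bounded below, hence there Cauchy sequences for the
  deformed metric are Cauchy for \<open>d\<close>.\<close>

section \<open>The density and its limit at 0\<close>

lemma density_val_pos: "t > 0 \<Longrightarrow> density_val \<rho> t = ennreal (\<rho> t)"
  by (simp add: density_val_def)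

text \<open>A nonincreasing function has its supremum as right limit at 0. Convergence has to be
  proved, possibly to \<open>top\<close>, because \<open>Lim\<close> is a choice operator that
  determines nothing on its own.\<close>

lemma density_val_0:
  assumes "metric_density \<rho>"
  shows "density_val \<rho> 0 = (SUP s\<in>{0<..}. ennreal (\<rho> s))"
proof -
  have "((\<lambda>s. ennreal (\<rho> s)) \<longlongrightarrow> (SUP s\<in>{0<..}. ennreal (\<rho> s))) (at_right 0)"
  proof (rule order_tendstoI)
    fix a assume "a < (SUP s\<in>{0<..}. ennreal (\<rho> s))"
    then obtain s where s: "s > 0" "a < ennreal (\<rho> s)"
      by (auto simp: less_SUP_iff)
    have "\<And>y. 0 < y \<Longrightarrow> y < s \<Longrightarrow> a < ennreal (\<rho> y)"
      using assms s unfolding metric_density_def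
      by (meson ennreal_leI less_imp_le less_le_trans)
    with s(1) show "\<forall>\<^sub>F x in at_right 0. a < ennreal (\<rho> x)"
      unfolding eventually_at_right_field by blast
  next
    fix a assume a: "(SUP s\<in>{0<..}. ennreal (\<rho> s)) < a"
    have "\<And>x. x > 0 \<Longrightarrow> ennreal (\<rho> x) < a"
      by (rule le_less_trans[OF SUP_upper a]) auto
    then show "\<forall>\<^sub>F x in at_right 0. ennreal (\<rho> x) < a"
      unfolding eventually_at_right_field by (intro exI[of _ 1]) auto
  qed
  then show ?thesis
    unfolding density_val_def by (simp add: tendsto_Lim)
qed

lemma density_val_antimono:
  assumes "metric_density \<rho>" "0 \<le> s" "s \<le> t"
  shows "density_val \<rho> t \<le> density_val \<rho> s"
proof (cases "s = 0")
  case True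
  show ?thesis
  proof (cases "t = 0")
    case False
    with True assms have "t \<in> {0<..}" by simp
    with True show ?thesis
      by (auto simp: density_val_pos density_val_0[OF assms(1)] intro: SUP_upper2)
  qed (use True in simp)
next
  case False
  with assms show ?thesis
    by (simp add: density_val_pos metric_density_def ennreal_leI)
qed

section \<open>The measure with density \<rho>\<close>

lemma emeasure_less_top_cover:
  assumes "emeasure M A < top" "emeasure M B < top" "C \<subseteq> A \<union> B" "A \<in> sets M" "B \<in> sets M"
  shows "emeasure M C < top"
proof -
  have "emeasure M C \<le> emeasure M (A \<union> B)"
    using assms by (intro emeasure_mono) auto
  also have "\<dots> \<le> emeasure M A + emeasure M B"
    using assms by (intro emeasure_subadditive)
  also have "\<dots> < top" using assms by simp
  finally show ?thesis .
qed

text \<open>Turning the integrals of \<rho> into a measure makes additivity and continuity along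
  monotone sequences of intervals available. The indicator cuts off the arguments where \<rho> is
  arbitrary.\<close>

definition density_measure :: "(real \<Rightarrow> real) \<Rightarrow> real measure" where
  "density_measure \<rho> = density lborel (\<lambda>t. ennreal (\<rho> t) * indicator {0<..} t)"

lemma sets_density_measure [simp, measurable_cong]: "sets (density_measure \<rho>) = sets borel"
  by (simp add: density_measure_def)

text \<open>Monotone functions are Borel measurable; the negative of \<rho> is the nondecreasing
  one.\<close>

lemma density_measurable:
  assumes "metric_density \<rho>"
  shows "(\<lambda>t. ennreal (\<rho> t) * indicator {0<..} t) \<in> borel_measurable borel"
proof -
  have "mono_on {0<..} (\<lambda>t. - \<rho> t)"
    using assms by (auto simp: mono_on_def metric_density_def)
  from borel_measurable_mono_on_fnc[OF this]
  have "(\<lambda>t. - (- \<rho> t)) \<in> borel_measurable (restrict_space borel {0<..})"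
    by (rule borel_measurable_uminus)
  then have "(\<lambda>t. ennreal (\<rho> t)) \<in> borel_measurable (restrict_space borel {0<..})"
    by simp
  then show ?thesis
    by (subst (asm) borel_measurable_restrict_space_iff_ennreal) (auto simp: mult.commute)
qed

lemma emeasure_density_measure:
  assumes "metric_density \<rho>" "A \<in> sets borel" "A \<subseteq> {0<..}"
  shows "emeasure (density_measure \<rho>) A = (\<integral>\<^sup>+t\<in>A. ennreal (\<rho> t) \<partial>lborel)"
proof -
  have "emeasure (density_measure \<rho>) A
      = (\<integral>\<^sup>+t. (ennreal (\<rho> t) * indicator {0<..} t) * indicator A t \<partial>lborel)"
    unfolding density_measure_def
    using assms density_measurable[OF assms(1)] by (subst emeasure_density) auto
  also have "\<dots> = (\<integral>\<^sup>+t\<in>A. ennreal (\<rho> t) \<partial>lborel)"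
    using assms(3) by (intro nn_integral_cong) (auto simp: indicator_def)
  finally show ?thesis .
qed

lemma density_measure_Ioc_lower:
  assumes "metric_density \<rho>" "0 \<le> s" "s \<le> t" "t > 0"
  shows "ennreal (\<rho> t * (t - s)) \<le> emeasure (density_measure \<rho>) {s<..t}"
proof -
  have "ennreal (\<rho> t * (t - s)) = (\<integral>\<^sup>+u\<in>{s<..t}. ennreal (\<rho> t) \<partial>lborel)"
    using assms by (simp add: nn_integral_cmult_indicator ennreal_mult'' metric_density_def)
  also have "\<dots> \<le> (\<integral>\<^sup>+u\<in>{s<..t}. ennreal (\<rho> u) \<partial>lborel)"
    using assms by (intro nn_integral_mono)
      (auto simp: indicator_def metric_density_def intro!: ennreal_leI)
  finally show ?thesis
    using assms by (subst emeasure_density_measure) auto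
qed

text \<open>The density on the interval is largest towards its left end. With
  \<open>density_val\<close> the left end may be 0, where the bound is infinite if the density blows
  up.\<close>

lemma density_measure_Ioc_upper:
  assumes "metric_density \<rho>" "0 \<le> s" "s \<le> t"
  shows "emeasure (density_measure \<rho>) {s<..t} \<le> density_val \<rho> s * ennreal (t - s)"
proof -
  have "ennreal (\<rho> u) \<le> density_val \<rho> s" if "s < u" for u
    using density_val_antimono[OF assms(1,2), of u] that assms(2) by (simp add: density_val_pos)
  then have "(\<integral>\<^sup>+u\<in>{s<..t}. ennreal (\<rho> u) \<partial>lborel)
      \<le> (\<integral>\<^sup>+u\<in>{s<..t}. density_val \<rho> s \<partial>lborel)"
    by (intro nn_integral_mono) (auto simp: indicator_def)
  also have "\<dots> = density_val \<rho> s * ennreal (t - s)"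
    using assms by (simp add: nn_integral_cmult_indicator)
  finally show ?thesis
    using assms by (subst emeasure_density_measure) auto
qed

text \<open>Continuity from below: uniform bounds on truncated integrals pass to the improper
  integral at 0.\<close>

lemma density_measure_Ioc_0_le:
  assumes "\<And>\<delta>. \<delta> > 0 \<Longrightarrow> emeasure (density_measure \<rho>) {\<delta><..t} \<le> B"
  shows "emeasure (density_measure \<rho>) {0<..t} \<le> B"
proof -
  have "incseq (\<lambda>n. {1 / real (Suc n)<..t})"
  proof (rule incseq_SucI)
    fix n
    have "1 / real (Suc (Suc n)) \<le> 1 / real (Suc n)"
      by (simp add: field_simps)
    then show "{1 / real (Suc n)<..t} \<le> {1 / real (Suc (Suc n))<..t}"
      by auto
  qed
  then have "(SUP n. emeasure (density_measure \<rho>) {1 / real (Suc n)<..t})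
      = emeasure (density_measure \<rho>) (\<Union>n. {1 / real (Suc n)<..t})"
    by (intro SUP_emeasure_incseq) auto
  also have "(\<Union>n. {1 / real (Suc n)<..t}) = {0<..t}"
  proof -
    have "\<exists>n. 1 / real (Suc n) < u" if "0 < u" for u
      using reals_Archimedean[OF that] by (simp add: inverse_eq_divide)
    moreover have "0 < u" if "1 / real (Suc n) < u" for u n
      by (rule le_less_trans[OF _ that]) simp
    ultimately show ?thesis by auto
  qed
  finally have "emeasure (density_measure \<rho>) {0<..t}
      = (SUP n. emeasure (density_measure \<rho>) {1 / real (Suc n)<..t})" ..
  also have "\<dots> \<le> B"
    by (intro SUP_least assms) auto
  finally show ?thesis .
qed

lemma density_measure_Ioi_le:
  assumes "\<And>n. emeasure (density_measure \<rho>) {s<..real n} \<le> B"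
  shows "emeasure (density_measure \<rho>) {s<..} \<le> B"
proof -
  have "incseq (\<lambda>n. {s<..real n})"
    by (rule incseq_SucI) auto
  then have "(SUP n. emeasure (density_measure \<rho>) {s<..real n})
      = emeasure (density_measure \<rho>) (\<Union>n. {s<..real n})"
    by (intro SUP_emeasure_incseq) auto
  also have "(\<Union>n. {s<..real n}) = {s<..}"
    by (auto intro: real_arch_simple)
  finally have "emeasure (density_measure \<rho>) {s<..}
      = (SUP n. emeasure (density_measure \<rho>) {s<..real n})" ..
  also have "\<dots> \<le> B"
    by (intro SUP_least assms)
  finally show ?thesis .
qed

text \<open>Continuity from above, along half-lines that decrease to the empty set and start with
  finite measure: the tails of a convergent integral become small.\<close>

lemma density_measure_tail:
  assumes "emeasure (density_measure \<rho>) {s<..} < top" "0 < e"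
  obtains r where "r \<ge> s" "emeasure (density_measure \<rho>) {r<..} < e"
proof -
  have "(\<lambda>n. emeasure (density_measure \<rho>) {max s (real n)<..})
      \<longlonglongrightarrow> emeasure (density_measure \<rho>) (\<Inter>n. {max s (real n)<..})"
  proof (rule Lim_emeasure_decseq)
    show "decseq (\<lambda>n. {max s (real n)<..})"
      by (auto simp: decseq_def)
    fix n
    have "emeasure (density_measure \<rho>) {max s (real n)<..} \<le> emeasure (density_measure \<rho>) {s<..}"
      by (intro emeasure_mono) auto
    then show "emeasure (density_measure \<rho>) {max s (real n)<..} \<noteq> \<infinity>"
      using assms(1) by auto
  qed auto
  also have "(\<Inter>n. {max s (real n)<..}) = {}"
  proof -
    have "\<exists>n. u \<notin> {max s (real n)<..}" for u
      using real_arch_simple[of u] by (auto simp: not_less)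
    then show ?thesis by blast
  qed
  finally have "\<forall>\<^sub>F n in sequentially. emeasure (density_measure \<rho>) {max s (real n)<..} < e"
    using assms(2) by (simp add: order_tendstoD(2))
  then obtain n where "emeasure (density_measure \<rho>) {max s (real n)<..} < e"
    by (auto simp: eventually_sequentially)
  then show thesis using that[of "max s (real n)"] by auto
qed

lemma density_measure_head:
  assumes "emeasure (density_measure \<rho>) {0<..t} < top" "0 < e" "0 < t"
  obtains r where "0 < r" "r \<le> t" "emeasure (density_measure \<rho>) {0<..r} < e"
proof -
  let ?r = "\<lambda>n. min t (1 / real (Suc n))"
  have "(\<lambda>n. emeasure (density_measure \<rho>) {0<..?r n})
      \<longlonglongrightarrow> emeasure (density_measure \<rho>) (\<Inter>n. {0<..?r n})"
  proof (rule Lim_emeasure_decseq)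
    show "decseq (\<lambda>n. {0<..?r n})"
    proof (rule decseq_SucI)
      fix n
      have "1 / real (Suc (Suc n)) \<le> 1 / real (Suc n)"
        by (simp add: field_simps)
      then show "{0<..?r (Suc n)} \<le> {0<..?r n}"
        by auto
    qed
    fix n
    have "emeasure (density_measure \<rho>) {0<..?r n} \<le> emeasure (density_measure \<rho>) {0<..t}"
      by (intro emeasure_mono) auto
    then show "emeasure (density_measure \<rho>) {0<..?r n} \<noteq> \<infinity>"
      using assms(1) by auto
  qed auto
  also have "(\<Inter>n. {0<..?r n}) = {}"
  proof -
    have "\<exists>n. u \<notin> {0<..?r n}" for u
    proof (cases "0 < u")
      case True
      then obtain n where "1 / real (Suc n) < u"
        using reals_Archimedean[of u] by (auto simp: inverse_eq_divide)
      then show ?thesis by (intro exI[of _ n]) auto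
    qed auto
    then show ?thesis by blast
  qed
  finally have "\<forall>\<^sub>F n in sequentially. emeasure (density_measure \<rho>) {0<..?r n} < e"
    using assms(2) by (simp add: order_tendstoD(2))
  then obtain n where "emeasure (density_measure \<rho>) {0<..?r n} < e"
    by (auto simp: eventually_sequentially)
  then show thesis using that[of "?r n"] assms(3) by auto
qed

section \<open>The deformed distance with values in \<open>ennreal\<close>\<close>

locale density_space = Metric_space Z d for Z :: "'a set" and d :: "'a \<Rightarrow> 'a \<Rightarrow> real" +
  fixes b :: 'a and \<rho> :: "real \<Rightarrow> real"
  assumes base: "b \<in> Z" and density: "metric_density \<rho>"
begin

abbreviation val :: "'a \<Rightarrow> ennreal" where
  "val x \<equiv> density_val \<rho> (d x b)"

abbreviation \<mu> :: "real set \<Rightarrow> ennreal" where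
  "\<mu> \<equiv> emeasure (density_measure \<rho>)"

abbreviation ddist :: "'a \<Rightarrow> 'a \<Rightarrow> real" where
  "ddist \<equiv> deformed_dist Z d b \<rho>"

definition step :: "'a \<Rightarrow> 'a \<Rightarrow> ennreal" where
  "step u v = (val u + val v) * ennreal (d u v)"

text \<open>The infimum before its conversion to \<open>real\<close>. Estimates can be stated here
  without finiteness side conditions.\<close>

definition edist :: "'a \<Rightarrow> 'a \<Rightarrow> ennreal" where
  "edist x y = Inf {chain_length d b \<rho> n c | n c. is_chain Z x y n c}"

lemma ddist_edist: "ddist x y = enn2real (edist x y)"
  by (simp add: deformed_dist_def edist_def)

lemma density_pos: "t > 0 \<Longrightarrow> \<rho> t > 0"
  using density by (simp add: metric_density_def)

lemma step_commute: "step u v = step v u"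
  by (simp add: step_def commute add.commute)

lemma chain_length_step: "chain_length d b \<rho> n c = (\<Sum>j<n. step (c j) (c (Suc j)))"
  unfolding chain_length_def step_def One_nat_def sum.atLeast1_atMost_eq
  by (intro sum.cong) (auto simp: commute add.commute)

lemma edist_le: "is_chain Z x y n c \<Longrightarrow> edist x y \<le> (\<Sum>j<n. step (c j) (c (Suc j)))"
  unfolding edist_def chain_length_step[symmetric] by (rule Inf_lower) auto

lemma edist_greatest:
  assumes "\<And>n c. is_chain Z x y n c \<Longrightarrow> B \<le> (\<Sum>j<n. step (c j) (c (Suc j)))"
  shows "B \<le> edist x y"
  unfolding edist_def using assms by (intro Inf_greatest) (auto simp: chain_length_step)

lemma edist_refl: "x \<in> Z \<Longrightarrow> edist x x = 0"
  using edist_le[of x x 0 "\<lambda>_. x"] by (simp add: is_chain_def)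

lemma edist_le_step:
  assumes "x \<in> Z" "y \<in> Z"
  shows "edist x y \<le> step x y"
  using edist_le[of x y 1 "\<lambda>j. if j = 0 then x else y"] assms by (simp add: is_chain_def)

lemma edist_commute: "edist x y = edist y x"
proof -
  have "edist x y \<le> edist y x" for x y
  proof (rule edist_greatest)
    fix n c assume c: "is_chain Z y x n c"
    have "is_chain Z x y n (\<lambda>j. c (n - j))"
      using c by (auto simp: is_chain_def)
    then have "edist x y \<le> (\<Sum>j<n. step (c (n - j)) (c (n - Suc j)))"
      by (rule edist_le)
    also have "\<dots> = (\<Sum>j<n. step (c (n - Suc j)) (c (Suc (n - Suc j))))"
      by (intro sum.cong) (auto simp: step_commute Suc_diff_Suc)
    also have "\<dots> = (\<Sum>j<n. step (c j) (c (Suc j)))"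
      by (rule sum.nat_diff_reindex)
    finally show "edist x y \<le> (\<Sum>j<n. step (c j) (c (Suc j)))" .
  qed
  then show ?thesis by (intro antisym)
qed

lemma edist_concat:
  assumes c: "is_chain Z x y n c" and c': "is_chain Z y z m c'"
  shows "edist x z \<le> (\<Sum>j<n. step (c j) (c (Suc j))) + (\<Sum>j<m. step (c' j) (c' (Suc j)))"
proof -
  \<comment> \<open>At \<open>j = n\<close> both branches give \<open>y\<close>, so
    \<open>e (n + j) = c' j\<close> holds from \<open>j = 0\<close> on.\<close>
  define e where "e j = (if j \<le> n then c j else c' (j - n))" for j
  have "is_chain Z x z (n + m) e"
    using c c' by (auto simp: is_chain_def e_def)
  then have "edist x z \<le> (\<Sum>j<n+m. step (e j) (e (Suc j)))"
    by (rule edist_le)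
  also have "\<dots> = (\<Sum>j<n. step (e j) (e (Suc j))) + (\<Sum>j<m. step (e (n + j)) (e (Suc (n + j))))"
    by (induction m) (simp_all add: add.assoc)
  also have "(\<Sum>j<n. step (e j) (e (Suc j))) = (\<Sum>j<n. step (c j) (c (Suc j)))"
    by (intro sum.cong) (auto simp: e_def)
  also have "(\<Sum>j<m. step (e (n + j)) (e (Suc (n + j)))) = (\<Sum>j<m. step (c' j) (c' (Suc j)))"
  proof -
    have "e (n + j) = c' j" for j
      using c c' by (auto simp: is_chain_def e_def)
    then show ?thesis
      by (simp flip: add_Suc_right)
  qed
  finally show ?thesis .
qed

lemma edist_triangle: "edist x z \<le> edist x y + edist y z"
proof (rule ennreal_le_epsilon)
  fix e :: real assume fin: "edist x y + edist y z < top" and e: "0 < e"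
  \<comment> \<open>Finiteness makes adding \<open>e/2\<close> a strict increase, so that some chain
    is shorter than the enlarged infimum.\<close>
  have near: "\<exists>n c. is_chain Z u v n c \<and> (\<Sum>j<n. step (c j) (c (Suc j))) < edist u v + ennreal (e/2)"
    if "edist u v < top" for u v
  proof -
    have "edist u v < edist u v + ennreal (e/2)"
      using that e ennreal_add_left_cancel_less[of "edist u v" 0 "ennreal (e/2)"] by auto
    then show ?thesis
      unfolding edist_def[of u v] by (subst (asm) Inf_less_iff) (auto simp: chain_length_step)
  qed
  obtain n c m c' where *: "is_chain Z x y n c" "is_chain Z y z m c'"
      "(\<Sum>j<n. step (c j) (c (Suc j))) < edist x y + ennreal (e/2)"
      "(\<Sum>j<m. step (c' j) (c' (Suc j))) < edist y z + ennreal (e/2)"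
    using near[of x y] near[of y z] fin by auto
  have "edist x z \<le> (\<Sum>j<n. step (c j) (c (Suc j))) + (\<Sum>j<m. step (c' j) (c' (Suc j)))"
    using * by (intro edist_concat)
  also have "\<dots> \<le> (edist x y + ennreal (e/2)) + (edist y z + ennreal (e/2))"
    using * by (intro add_mono less_imp_le)
  also have "\<dots> = edist x y + edist y z + (ennreal (e/2) + ennreal (e/2))"
    by (simp add: ac_simps)
  also have "ennreal (e/2) + ennreal (e/2) = ennreal e"
    using e by (simp flip: ennreal_plus)
  finally show "edist x z \<le> edist x y + edist y z + ennreal e" .
qed

section \<open>Lower bounds for the deformed distance\<close>

text \<open>Induction along a chain adds up the bounds for its single steps. The two uses take
  one-sided functions \<open>L\<close>: the measure of an interval of radii, and the positive part
  of a difference of potentials.\<close>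

lemma edist_lower_bound:
  fixes L :: "'a \<Rightarrow> 'a \<Rightarrow> ennreal"
  assumes refl: "\<And>u. L u u = 0"
    and tri: "\<And>u v w. L u w \<le> L u v + L v w"
    and le: "\<And>u v. u \<in> Z \<Longrightarrow> v \<in> Z \<Longrightarrow> L u v \<le> step u v"
  shows "L x y \<le> edist x y"
proof (rule edist_greatest)
  fix n c assume c: "is_chain Z x y n c"
  have "m \<le> n \<Longrightarrow> L (c 0) (c m) \<le> (\<Sum>j<m. step (c j) (c (Suc j)))" for m
  proof (induction m)
    case 0
    show ?case by (simp add: refl)
  next
    case (Suc m)
    have "L (c 0) (c (Suc m)) \<le> L (c 0) (c m) + L (c m) (c (Suc m))"
      by (rule tri)
    also have "\<dots> \<le> (\<Sum>j<m. step (c j) (c (Suc j))) + step (c m) (c (Suc m))"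
      using Suc c by (intro add_mono le) (auto simp: is_chain_def)
    finally show ?case by simp
  qed
  from this[of n] show "L x y \<le> (\<Sum>j<n. step (c j) (c (Suc j)))"
    using c by (simp add: is_chain_def)
qed

text \<open>For one step outwards, \<open>d u v\<close> is at least the length of the interval of
  radii and \<open>val u\<close> bounds the density on it. For a step inwards the interval is
  empty.\<close>

lemma density_measure_le_edist: "\<mu> {d x b<..d y b} \<le> edist x y"
proof (rule edist_lower_bound)
  fix u v w
  have "\<mu> {d u b<..d w b} \<le> \<mu> ({d u b<..d v b} \<union> {d v b<..d w b})"
    by (intro emeasure_mono) auto
  also have "\<dots> \<le> \<mu> {d u b<..d v b} + \<mu> {d v b<..d w b}"
    by (intro emeasure_subadditive) auto
  finally show "\<mu> {d u b<..d w b} \<le> \<mu> {d u b<..d v b} + \<mu> {d v b<..d w b}" .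
next
  fix u v assume Z: "u \<in> Z" "v \<in> Z"
  show "\<mu> {d u b<..d v b} \<le> step u v"
  proof (cases "d u b \<le> d v b")
    case True
    have "\<mu> {d u b<..d v b} \<le> val u * ennreal (d v b - d u b)"
      using density True by (intro density_measure_Ioc_upper) auto
    also have "\<dots> \<le> step u v"
      unfolding step_def using triangle[of v u b] Z base commute[of u v]
      by (intro mult_mono ennreal_leI) auto
    finally show ?thesis .
  qed simp
qed simp

text \<open>The potential \<open>u \<mapsto> \<rho> R * min (d x u) (R - d x b)\<close> is constant outside the ball of
  radius \<open>R\<close>, and inside this ball the density is at least \<open>\<rho> R\<close>.\<close>

lemma edist_lower_local:
  assumes x: "x \<in> Z" and R: "d x b < R"
  shows "ennreal (\<rho> R * min (d x y) (R - d x b)) \<le> edist x y"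
proof -
  have R0: "R > 0" using R nonneg[of x b] by linarith
  define \<phi> where "\<phi> u = \<rho> R * min (d x u) (R - d x b)" for u
  have "ennreal (\<phi> y - \<phi> x) \<le> edist x y"
  proof (rule edist_lower_bound)
    fix u v w
    \<comment> \<open>\<open>ennreal\<close> sends negative numbers to 0, so the triangle inequality
      for \<open>L\<close> is the subadditivity of the positive part.\<close>
    have "ennreal (r + s) \<le> ennreal r + ennreal s" for r s :: real
      by (cases "0 \<le> r"; cases "0 \<le> s") (auto simp: ennreal_neg intro!: ennreal_leI)
    from this[of "\<phi> v - \<phi> u" "\<phi> w - \<phi> v"]
    show "ennreal (\<phi> w - \<phi> u) \<le> ennreal (\<phi> v - \<phi> u) + ennreal (\<phi> w - \<phi> v)"
      by simp
  next
    fix u v assume uv: "u \<in> Z" "v \<in> Z"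
    show "ennreal (\<phi> v - \<phi> u) \<le> step u v"
    proof (cases "d u b < R \<or> d v b < R")
      case False
      then have "R - d x b \<le> d x u" "R - d x b \<le> d x v"
        using triangle[OF uv(1) x base] triangle[OF uv(2) x base] commute[of x u] commute[of x v]
        by auto
      then show ?thesis by (simp add: \<phi>_def)
    next
      case True
      \<comment> \<open>One end point inside the ball suffices, since a step is weighted by the sum
        of both densities.\<close>
      have "ennreal (\<rho> R) \<le> val p" if "d p b < R" for p
        using density_val_antimono[OF density, of "d p b" R] that R0 by (simp add: density_val_pos)
      with True have *: "ennreal (\<rho> R) \<le> val u + val v"
        by (metis add.commute add_increasing zero_le)
      have "\<phi> v - \<phi> u = \<rho> R * (min (d x v) (R - d x b) - min (d x u) (R - d x b))"
        by (simp add: \<phi>_def right_diff_distrib)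
      also have "\<dots> \<le> \<rho> R * d u v"
        using triangle[of x u v] uv x density_pos[OF R0] nonneg[of u v]
        by (intro mult_left_mono) linarith+
      finally have "ennreal (\<phi> v - \<phi> u) \<le> ennreal (\<rho> R) * ennreal (d u v)"
        using density_pos[OF R0] by (simp flip: ennreal_mult add: ennreal_leI)
      also have "\<dots> \<le> step u v"
        unfolding step_def by (intro mult_right_mono *) auto
      finally show ?thesis .
    qed
  qed simp
  then show ?thesis using x R by (simp add: \<phi>_def)
qed

section \<open>Upper bounds from chains through shells\<close>

text \<open>A single step costs at most \<open>2 * \<rho> r * (2 * \<kappa> ^ 3 * r)\<close>, while
  the measure of the shell is at least \<open>\<rho> r * (r - r / \<kappa>)\<close>; the constant is
  the quotient. The shell is taken below \<open>r\<close> because the density there is at least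
  \<open>\<rho> r\<close>, whereas above \<open>r\<close> it may drop at once.\<close>

lemma edist_shell_le:
  assumes \<kappa>: "\<kappa> > 1" and r: "r > 0" and xy: "x \<in> Z" "y \<in> Z"
    and x: "r \<le> d x b" "d x b \<le> \<kappa> ^ 3 * r" and y: "r \<le> d y b" "d y b \<le> \<kappa> ^ 3 * r"
  shows "edist x y \<le> ennreal (4 * \<kappa> ^ 4 / (\<kappa> - 1)) * \<mu> {r / \<kappa><..r}"
proof -
  have val: "val p \<le> ennreal (\<rho> r)" if "r \<le> d p b" for p
    using density_val_antimono[OF density _ that] r by (simp add: density_val_pos)
  have "d x y \<le> 2 * \<kappa> ^ 3 * r"
    using triangle'[OF xy(1) base xy(2)] x y by linarith
  then have "step x y \<le> (ennreal (\<rho> r) + ennreal (\<rho> r)) * ennreal (2 * \<kappa> ^ 3 * r)"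
    unfolding step_def using x y by (intro mult_mono add_mono val ennreal_leI) auto
  also have "\<dots> = ennreal (2 * \<rho> r * (2 * \<kappa> ^ 3 * r))"
    using density_pos[OF r] \<kappa> r by (simp flip: ennreal_plus ennreal_mult)
  also have "2 * \<rho> r * (2 * \<kappa> ^ 3 * r) = 4 * \<kappa> ^ 4 / (\<kappa> - 1) * (\<rho> r * (r - r / \<kappa>))"
    using \<kappa> by (simp add: divide_simps power_numeral_reduce) (simp add: algebra_simps)
  also have "ennreal \<dots> = ennreal (4 * \<kappa> ^ 4 / (\<kappa> - 1)) * ennreal (\<rho> r * (r - r / \<kappa>))"
    using \<kappa> by (intro ennreal_mult') simp
  also have "\<dots> \<le> ennreal (4 * \<kappa> ^ 4 / (\<kappa> - 1)) * \<mu> {r / \<kappa><..r}"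
    using \<kappa> r density by (intro mult_left_mono density_measure_Ioc_lower) (auto simp: field_simps)
  finally show ?thesis
    using edist_le_step[OF xy] by (rule order_trans[rotated])
qed

text \<open>An intermediate point \<open>w\<close> is chosen between \<open>\<bar>y\<bar> / \<kappa>\<^sup>2\<close> and \<open>\<bar>y\<bar> / \<kappa>\<close>. The measure of
  the shell just below \<open>\<bar>w\<bar>\<close> pays for the step from \<open>w\<close> to \<open>y\<close>, and this shell is disjoint from
  those already used.\<close>

lemma edist_radial_le:
  assumes \<kappa>: "\<kappa> > 1" and x: "x \<in> Z" "d x b > 0" and y: "y \<in> Z" "\<kappa> * d x b \<le> d y b"
    and shells: "\<And>r. d x b \<le> r \<Longrightarrow> r \<le> d y b \<Longrightarrow> \<exists>w\<in>Z. r \<le> d w b \<and> d w b < \<kappa> * r"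
  shows "edist x y \<le> ennreal (4 * \<kappa> ^ 4 / (\<kappa> - 1)) * \<mu> {d x b / \<kappa><..d y b / \<kappa>}"
proof -
  let ?C = "ennreal (4 * \<kappa> ^ 4 / (\<kappa> - 1))"
  \<comment> \<open>The induction runs on the number of factors \<kappa> that separate the two
    radii.\<close>
  have "edist x y \<le> ?C * \<mu> {d x b / \<kappa><..d y b / \<kappa>}" if "d y b \<le> \<kappa> ^ n * d x b" for n
    using y shells that
  proof (induction n arbitrary: y)
    \<comment> \<open>Contradictory: here \<open>d y b \<le> d x b\<close>, but
      \<open>d x b < \<kappa> * d x b \<le> d y b\<close>.\<close>
    case 0
    then show ?case
      using mult_strict_right_mono[OF \<kappa> x(2)] by simp
  next
    case (Suc n)
    have le: "d x b \<le> d y b"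
      using mult_strict_right_mono[OF \<kappa> x(2)] Suc.prems(2) by linarith
    show ?case
    proof (cases "d y b \<le> \<kappa> ^ 3 * d x b")
      case True
      have "edist x y \<le> ?C * \<mu> {d x b / \<kappa><..d x b}"
        using \<kappa> x Suc.prems(1) True le mult_right_mono[of 1 "\<kappa> ^ 3" "d x b"]
        by (intro edist_shell_le) auto
      also have "\<dots> \<le> ?C * \<mu> {d x b / \<kappa><..d y b / \<kappa>}"
      proof (intro mult_left_mono emeasure_mono)
        have "d x b \<le> d y b / \<kappa>"
          using Suc.prems(2) \<kappa> by (simp add: pos_le_divide_eq mult.commute)
        then show "{d x b / \<kappa><..d x b} \<subseteq> {d x b / \<kappa><..d y b / \<kappa>}" by auto
      qed auto
      finally show ?thesis .
    next
      case False
      \<comment> \<open>Beyond a factor \<open>\<kappa> ^ 3\<close> there is room for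
        \<open>w\<close>: since \<open>r\<close> exceeds \<open>\<kappa> * d x b\<close>, the
        separation hypothesis holds for \<open>x\<close> and \<open>w\<close>, and
        \<open>d w b < d y b / \<kappa>\<close> lowers the exponent to \<open>n\<close>.\<close>
      define r where "r = d y b / \<kappa> ^ 2"
      have y_r: "d y b = \<kappa> * (\<kappa> * r)"
        using \<kappa> by (simp add: r_def power2_eq_square)
      have "\<kappa> * (\<kappa> * (\<kappa> * d x b)) < \<kappa> * (\<kappa> * r)"
        using False by (simp add: y_r power3_eq_cube mult.assoc)
      then have r: "\<kappa> * d x b < r"
        using \<kappa> by simp
      then have r': "d x b < r"
        using mult_strict_right_mono[OF \<kappa> x(2)] by simp
      then have r0: "0 < r" using x(2) by simp
      have \<kappa>r: "r < \<kappa> * r" "\<kappa> * r < \<kappa> * (\<kappa> * r)"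
        using \<kappa> r0 by auto
      then obtain w where w: "w \<in> Z" "r \<le> d w b" "d w b < \<kappa> * r"
        using Suc.prems(3)[of r] r' y_r by auto
      have w0: "0 < d w b" using w r0 by simp
      have wy: "\<kappa> * d w b < d y b" "d y b \<le> \<kappa> ^ 3 * d w b" "d w b < d y b"
      proof -
        show *: "\<kappa> * d w b < d y b" using \<kappa> w by (simp add: y_r)
        show "d w b < d y b" using w \<kappa>r y_r by simp
        have "\<kappa> * (\<kappa> * r) \<le> \<kappa> * (\<kappa> * d w b)" using \<kappa> w by simp
        also have "\<dots> \<le> \<kappa> ^ 3 * d w b"
          using \<kappa> w0 by (simp add: power3_eq_cube mult.assoc)
        finally show "d y b \<le> \<kappa> ^ 3 * d w b" by (simp add: y_r)
      qed
      have "\<kappa> * d w b \<le> \<kappa> * (\<kappa> ^ n * d x b)"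
        using wy(1) Suc.prems(4) by simp
      then have "d w b \<le> \<kappa> ^ n * d x b" using \<kappa> by simp
      then have xw: "edist x w \<le> ?C * \<mu> {d x b / \<kappa><..d w b / \<kappa>}"
        using w r wy Suc.prems(3) by (intro Suc.IH) auto
      have wy': "edist w y \<le> ?C * \<mu> {d w b / \<kappa><..d w b}"
        using \<kappa> w0 w(1) Suc.prems(1) wy mult_right_mono[of 1 "\<kappa> ^ 3" "d w b"]
        by (intro edist_shell_le) auto
      have "edist x y \<le> edist x w + edist w y"
        by (rule edist_triangle)
      also have "\<dots> \<le> ?C * (\<mu> {d x b / \<kappa><..d w b / \<kappa>} + \<mu> {d w b / \<kappa><..d w b})"
        unfolding distrib_left by (intro add_mono xw wy')
      also have "\<mu> {d x b / \<kappa><..d w b / \<kappa>} + \<mu> {d w b / \<kappa><..d w b}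
          = \<mu> ({d x b / \<kappa><..d w b / \<kappa>} \<union> {d w b / \<kappa><..d w b})"
        by (intro plus_emeasure) auto
      also have "?C * \<dots> \<le> ?C * \<mu> {d x b / \<kappa><..d y b / \<kappa>}"
      proof (intro mult_left_mono emeasure_mono)
        have "d x b / \<kappa> \<le> d w b / \<kappa>" "d w b / \<kappa> \<le> d y b / \<kappa>" "d w b \<le> d y b / \<kappa>"
          using \<kappa> r' w wy by (auto simp: field_simps)
        then show "{d x b / \<kappa><..d w b / \<kappa>} \<union> {d w b / \<kappa><..d w b} \<subseteq> {d x b / \<kappa><..d y b / \<kappa>}"
          by auto
      qed auto
      finally show ?thesis .
    qed
  qed
  moreover obtain n where "d y b / d x b < \<kappa> ^ n"
    using real_arch_pow[OF \<kappa>] by blast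
  then have "d y b \<le> \<kappa> ^ n * d x b"
    using x(2) by (simp add: pos_divide_less_eq)
  ultimately show ?thesis by blast
qed

text \<open>Radii separated by a factor \<kappa> are covered by the radial estimate, closer ones by
  a single step; symmetry then removes the order of the two points.\<close>

lemma edist_annulus_le:
  assumes \<kappa>: "\<kappa> > 1" and s: "s > 0"
    and shells: "\<And>r. s \<le> r \<Longrightarrow> r \<le> R \<Longrightarrow> \<exists>w\<in>Z. r \<le> d w b \<and> d w b < \<kappa> * r"
    and xy: "x \<in> Z" "s \<le> d x b" "d x b \<le> R" "y \<in> Z" "s \<le> d y b" "d y b \<le> R"
  shows "edist x y \<le> ennreal (4 * \<kappa> ^ 4 / (\<kappa> - 1)) * \<mu> {s / \<kappa><..R}"
proof -
  let ?C = "ennreal (4 * \<kappa> ^ 4 / (\<kappa> - 1))"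
  have *: "edist x y \<le> ?C * \<mu> {s / \<kappa><..R}"
    if xy: "x \<in> Z" "y \<in> Z" "s \<le> d x b" "d x b \<le> d y b" "d y b \<le> R" for x y
  proof -
    have sx: "s / \<kappa> \<le> d x b / \<kappa>"
      using \<kappa> xy by (intro divide_right_mono) auto
    have "edist x y \<le> ?C * \<mu> {d x b / \<kappa><..d y b}"
    proof (cases "\<kappa> * d x b \<le> d y b")
      case True
      have "edist x y \<le> ?C * \<mu> {d x b / \<kappa><..d y b / \<kappa>}"
        using \<kappa> s xy True by (intro edist_radial_le shells) auto
      also have "\<dots> \<le> ?C * \<mu> {d x b / \<kappa><..d y b}"
      proof (intro mult_left_mono emeasure_mono)
        have "d y b / \<kappa> \<le> d y b"
          using \<kappa> mult_right_mono[of 1 \<kappa> "d y b"] by (simp add: field_simps)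
        then show "{d x b / \<kappa><..d y b / \<kappa>} \<subseteq> {d x b / \<kappa><..d y b}" by auto
      qed auto
      finally show ?thesis .
    next
      case False
      have "\<kappa> * d x b \<le> \<kappa> ^ 3 * d x b"
        using \<kappa> power_increasing[of 1 3 \<kappa>] by (intro mult_right_mono) auto
      with False have "d y b \<le> \<kappa> ^ 3 * d x b" "d x b \<le> \<kappa> ^ 3 * d x b"
        using xy by linarith+
      then have "edist x y \<le> ?C * \<mu> {d x b / \<kappa><..d x b}"
        using \<kappa> s xy False by (intro edist_shell_le) auto
      also have "\<dots> \<le> ?C * \<mu> {d x b / \<kappa><..d y b}"
        using xy by (intro mult_left_mono emeasure_mono) auto
      finally show ?thesis .
    qed
    also have "\<dots> \<le> ?C * \<mu> {s / \<kappa><..R}"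
      using sx xy by (intro mult_left_mono emeasure_mono) auto
    finally show ?thesis .
  qed
  show ?thesis
    using *[of x y] *[of y x] xy edist_commute[of x y] by (cases "d x b \<le> d y b") auto
qed

section \<open>The real-valued deformed metric\<close>

lemma edist_less_top:
  assumes "x \<in> Z" "y \<in> Z" "val x < top" "val y < top"
  shows "edist x y < top"
proof -
  have "step x y < top"
    unfolding step_def using assms by (simp add: ennreal_mult_less_top)
  then show ?thesis
    using edist_le_step[OF assms(1,2)] by (rule le_less_trans[rotated])
qed

lemma val_less_top: "x \<in> Z - {b} \<Longrightarrow> val x < top"
  using base by (simp add: density_val_pos)

lemma val_less_top': "density_val \<rho> 0 < top \<Longrightarrow> val x < top"
  using density_val_antimono[OF density, of 0 "d x b"] by (simp add: le_less_trans)

lemma ddist_nonneg: "0 \<le> ddist x y"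
  by (simp add: ddist_edist)

text \<open>\<open>enn2real\<close> sends \<open>top\<close> to 0, so the transfer rests on
  \<open>edist\<close> being finite. The condition on \<open>B\<close> is there because
  \<open>ennreal\<close> sends negative bounds to 0.\<close>

lemma ddist_le_iff:
  assumes "x \<in> Z" "y \<in> Z" "val x < top" "val y < top" "0 \<le> B"
  shows "ddist x y \<le> B \<longleftrightarrow> edist x y \<le> ennreal B"
  using edist_less_top[OF assms(1-4)] assms(5)
  by (cases "edist x y") (simp_all add: ddist_edist)

lemma ddist_less_iff:
  assumes "x \<in> Z" "y \<in> Z" "val x < top" "val y < top"
  shows "ddist x y < B \<longleftrightarrow> edist x y < ennreal B"
  using edist_less_top[OF assms(1-4)]
  by (simp add: ddist_edist)

text \<open>\<open>M\<close> will be \<open>Z\<close> if the density is finite at 0, and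
  \<open>Z - {b}\<close> in general. Definiteness comes from the local lower bound with radius
  \<open>d x b + 1\<close>, which leaves the cutoff 1.\<close>

lemma Metric_space_ddist:
  assumes M: "M \<subseteq> Z" and fin: "\<And>x. x \<in> M \<Longrightarrow> val x < top"
  shows "Metric_space M ddist"
proof
  fix x y show "0 \<le> ddist x y" by (rule ddist_nonneg)
next
  fix x y show "ddist x y = ddist y x"
    by (simp add: ddist_edist edist_commute)
next
  fix x y assume xy: "x \<in> M" "y \<in> M"
  show "ddist x y = 0 \<longleftrightarrow> x = y"
  proof
    assume 0: "ddist x y = 0"
    have "ddist x y \<le> 0 \<longleftrightarrow> edist x y \<le> ennreal 0"
      using xy M fin by (intro ddist_le_iff) auto
    with 0 have "edist x y = 0" by simp
    then have "ennreal (\<rho> (d x b + 1) * min (d x y) (d x b + 1 - d x b)) \<le> 0"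
      using edist_lower_local[of x "d x b + 1" y] xy M by auto
    then have "\<rho> (d x b + 1) * min (d x y) 1 \<le> 0"
      by (simp add: ennreal_eq_0_iff)
    moreover have "\<rho> (d x b + 1) > 0" by (intro density_pos) (simp add: add_nonneg_pos)
    ultimately have "d x y \<le> 0"
      by (auto simp: mult_le_0_iff min_def split: if_splits)
    then show "x = y" using xy M nonneg[of x y] zero[of x y] by auto
  next
    assume "x = y" then show "ddist x y = 0" using xy M edist_refl by (auto simp: ddist_edist)
  qed
next
  fix x y z assume xyz: "x \<in> M" "y \<in> M" "z \<in> M"
  have fin': "edist x y < top" "edist y z < top"
    using xyz M by (intro edist_less_top fin; blast)+
  have "enn2real (edist x z) \<le> enn2real (edist x y + edist y z)"
    using fin' by (intro enn2real_mono edist_triangle) auto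
  also have "\<dots> = enn2real (edist x y) + enn2real (edist y z)"
    using fin' by (intro enn2real_plus) auto
  finally show "ddist x z \<le> ddist x y + ddist y z"
    by (simp add: ddist_edist)
qed

text \<open>The one-step chain shows that convergence for \<open>d\<close> implies convergence for
  \<open>ddist\<close> wherever the density is bounded.\<close>

lemma ddist_le_dist:
  assumes "x \<in> Z" "y \<in> Z" "val x \<le> ennreal k" "val y \<le> ennreal k" "0 \<le> k"
  shows "ddist x y \<le> 2 * k * d x y"
proof -
  have "edist x y \<le> (ennreal k + ennreal k) * ennreal (d x y)"
    by (rule order_trans[OF edist_le_step[OF assms(1,2)]])
      (auto simp: step_def intro!: mult_mono add_mono assms)
  also have "\<dots> = ennreal (2 * k * d x y)"
    using assms(5) by (simp flip: ennreal_plus ennreal_mult)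
  finally show ?thesis
    unfolding ddist_edist using assms(5) by (intro enn2real_leI) auto
qed

section \<open>Deformed Cauchy sequences in a ball\<close>

text \<open>In a ball the density is bounded below, so the local lower bound turns the Cauchy
  condition for \<open>edist\<close> into the one for \<open>d\<close>.\<close>

lemma bounded_Cauchy_convergent:
  assumes complete: mcomplete and \<sigma>: "range \<sigma> \<subseteq> Z" and bounded: "\<And>n. d (\<sigma> n) b \<le> R"
    and Cauchy: "\<And>e. e > 0 \<Longrightarrow> \<exists>N. \<forall>m\<ge>N. \<forall>n\<ge>N. edist (\<sigma> m) (\<sigma> n) < ennreal e"
  obtains x where "x \<in> Z" "(\<lambda>n. d (\<sigma> n) x) \<longlonglongrightarrow> 0"
proof -
  \<comment> \<open>The margin 1 keeps the cutoff \<open>R' - d (\<sigma> m) b\<close> at least 1. A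
    minimum below \<open>min e 1\<close> is then the distance itself.\<close>
  define R' where "R' = R + 1"
  have "0 \<le> R" using bounded[of 0] nonneg[of "\<sigma> 0" b] by linarith
  then have R': "R' > 0" by (simp add: R'_def)
  have "MCauchy \<sigma>"
    unfolding MCauchy_def
  proof (intro conjI allI impI \<sigma>)
    fix e :: real assume e: "e > 0"
    then obtain N where N: "\<And>m n. m \<ge> N \<Longrightarrow> n \<ge> N
        \<Longrightarrow> edist (\<sigma> m) (\<sigma> n) < ennreal (\<rho> R' * min e 1)"
      using Cauchy[of "\<rho> R' * min e 1"] density_pos[OF R'] by auto
    have "d (\<sigma> m) (\<sigma> n) < e" if mn: "m \<ge> N" "n \<ge> N" for m n
    proof -
      have m: "d (\<sigma> m) b \<le> R' - 1"
        using bounded[of m] by (simp add: R'_def)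
      then have "ennreal (\<rho> R' * min (d (\<sigma> m) (\<sigma> n)) (R' - d (\<sigma> m) b)) \<le> edist (\<sigma> m) (\<sigma> n)"
        using \<sigma> by (intro edist_lower_local) auto
      also have "\<dots> < ennreal (\<rho> R' * min e 1)"
        using mn by (rule N)
      finally have "\<rho> R' * min (d (\<sigma> m) (\<sigma> n)) (R' - d (\<sigma> m) b) < \<rho> R' * min e 1"
        using density_pos[OF R'] m by (subst (asm) ennreal_less_iff) auto
      then have "min (d (\<sigma> m) (\<sigma> n)) (R' - d (\<sigma> m) b) < min e 1"
        using density_pos[OF R'] by simp
      then show ?thesis using m by linarith
    qed
    then show "\<exists>N. \<forall>n n'. N \<le> n \<longrightarrow> N \<le> n' \<longrightarrow> d (\<sigma> n) (\<sigma> n') < e" by blast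
  qed
  then obtain x where "limitin mtopology \<sigma> x sequentially"
    using complete by (auto simp: mcomplete_def)
  then show thesis
    using that by (auto simp: limitin_metric_dist_null)
qed

lemma mbounded_iff_base: "mbounded Z \<longleftrightarrow> (\<exists>R. \<forall>x\<in>Z. d x b \<le> R)"
proof
  assume "mbounded Z"
  then show "\<exists>R. \<forall>x\<in>Z. d x b \<le> R"
    using base by (auto simp: mbounded_alt)
next
  assume "\<exists>R. \<forall>x\<in>Z. d x b \<le> R"
  then obtain R where "\<forall>x\<in>Z. d x b \<le> R" ..
  then have "d b x \<le> R" if "x \<in> Z" for x
    using that by (subst commute) simp
  then have "Z \<subseteq> mcball b R"
    using base by auto
  then show "mbounded Z" unfolding mbounded_def by blast
qed

section \<open>The new point of the completion\<close>

text \<open>If all points of \<open>Z\<close> near \<open>q\<close> had bounded radius, a sequence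
  approaching \<open>q\<close> would be Cauchy for \<open>d\<close>, hence converge in
  \<open>Z\<close>, and \<open>q\<close> would be the image of its limit.\<close>

lemma in_completion_far:
  assumes complete: mcomplete and fin: "density_val \<rho> 0 < top"
    and m: "is_completion Z ddist m f" and q: "q \<in> mspace m" "q \<notin> f ` Z" and e: "e > 0"
  obtains x where "x \<in> Z" "R \<le> d x b" "mdist m q (f x) < e"
proof (rule ccontr)
  assume "\<not> thesis"
  then have near: "\<And>x. x \<in> Z \<Longrightarrow> mdist m q (f x) < e \<Longrightarrow> d x b \<le> R"
    using that by fastforce
  interpret Cm: Metric_space "mspace m" "mdist m" by (rule Metric_space_mspace_mdist)
  have f: "f x \<in> mspace m" if "x \<in> Z" for x
    using m that by (auto simp: is_completion_def)
  have iso: "mdist m (f x) (f y) = ddist x y" if "x \<in> Z" "y \<in> Z" for x y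
    using m that by (auto simp: is_completion_def)
  have "q \<in> Cm.mtopology closure_of (f ` Z)"
    using m q by (simp add: is_completion_def mtopology_of_def)
  then have dense: "\<exists>x\<in>Z. mdist m q (f x) < \<delta>" if "\<delta> > 0" for \<delta>
    using that by (auto simp: Cm.metric_closure_of)
  \<comment> \<open>The bound \<open>e\<close> keeps the sequence in the ball supplied by
    \<open>near\<close>; the other bound makes it converge to \<open>q\<close>.\<close>
  have "\<forall>n. \<exists>x. x \<in> Z \<and> mdist m q (f x) < min e (1 / real (Suc n))"
    using dense e by (metis less_numeral_extra(1) min_less_iff_conj of_nat_0_less_iff zero_less_Suc zero_less_divide_iff)
  then obtain \<sigma> where \<sigma>: "\<And>n. \<sigma> n \<in> Z" "\<And>n. mdist m q (f (\<sigma> n)) < min e (1 / real (Suc n))"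
    by metis
  have lim: "(\<lambda>n. mdist m q (f (\<sigma> n))) \<longlonglongrightarrow> 0"
  proof (rule tendsto_sandwich[OF _ _ tendsto_const])
    show "(\<lambda>n. 1 / real (Suc n)) \<longlonglongrightarrow> 0" by (rule LIMSEQ_Suc[OF lim_1_over_n])
    show "\<forall>\<^sub>F n in sequentially. mdist m q (f (\<sigma> n)) \<le> 1 / real (Suc n)"
      using \<sigma>(2) by (intro always_eventually) (auto intro: less_imp_le)
  qed simp
  have Cauchy: "\<exists>N. \<forall>j\<ge>N. \<forall>n\<ge>N. edist (\<sigma> j) (\<sigma> n) < ennreal \<delta>" if "\<delta> > 0" for \<delta>
  proof -
    have "\<forall>\<^sub>F n in sequentially. mdist m q (f (\<sigma> n)) < \<delta> / 2"
      using order_tendstoD(2)[OF lim, of "\<delta> / 2"] that by simp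
    then obtain N where N: "\<And>n. n \<ge> N \<Longrightarrow> mdist m q (f (\<sigma> n)) < \<delta> / 2"
      by (auto simp: eventually_sequentially)
    have "edist (\<sigma> j) (\<sigma> n) < ennreal \<delta>" if "j \<ge> N" "n \<ge> N" for j n
    proof -
      have "ddist (\<sigma> j) (\<sigma> n) \<le> mdist m q (f (\<sigma> j)) + mdist m q (f (\<sigma> n))"
        using Cm.triangle''[of "f (\<sigma> j)" q "f (\<sigma> n)"] \<sigma>(1) f q iso by simp
      then have "ddist (\<sigma> j) (\<sigma> n) < \<delta>"
        using N[of j] N[of n] that by linarith
      then show ?thesis
        by (subst (asm) ddist_less_iff) (auto intro!: \<sigma> val_less_top' fin)
    qed
    then show ?thesis by blast
  qed
  have "range \<sigma> \<subseteq> Z" "\<And>n. d (\<sigma> n) b \<le> R"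
    using \<sigma> near by auto
  from bounded_Cauchy_convergent[OF complete this Cauchy]
  obtain x where x: "x \<in> Z" "(\<lambda>n. d (\<sigma> n) x) \<longlonglongrightarrow> 0"
    by blast
  \<comment> \<open>The finite value at 0 bounds the density everywhere, so convergence for
    \<open>d\<close> gives convergence for \<open>ddist\<close>, even if the limit is
    \<open>b\<close>.\<close>
  define k where "k = enn2real (density_val \<rho> 0)"
  have k: "val y \<le> ennreal k" for y
    using fin density_val_antimono[OF density, of 0 "d y b"] by (simp add: k_def)
  have "mdist m q (f x) \<le> mdist m q (f (\<sigma> n)) + 2 * k * d (\<sigma> n) x" for n
    using Cm.triangle[of q "f (\<sigma> n)" "f x"] \<sigma>(1)[of n] x(1) f q(1) iso[of "\<sigma> n" x]
      ddist_le_dist[OF \<sigma>(1)[of n] x(1) k k] by (simp add: k_def)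
  moreover have "(\<lambda>n. mdist m q (f (\<sigma> n)) + 2 * k * d (\<sigma> n) x) \<longlonglongrightarrow> 0 + 2 * k * 0"
    by (intro tendsto_intros lim x)
  ultimately have "mdist m q (f x) \<le> 0"
    using tendsto_lowerbound[of "\<lambda>n. mdist m q (f (\<sigma> n)) + 2 * k * d (\<sigma> n) x" 0 sequentially "mdist m q (f x)"] by simp
  then have "q = f x"
    using q f x(1) Cm.zero[of q "f x"] Cm.nonneg[of q "f x"] by simp
  with q(2) x(1) show False by auto
qed

text \<open>A sequence of radii tending to infinity is Cauchy by \<open>tail\<close>, and its limit
  is the new point. Any other new point is also approached by points far out, and these merge with
  the former.\<close>

lemma completion_adds_one_pointI:
  assumes complete: mcomplete and fin: "density_val \<rho> 0 < top"
    and far: "\<And>r. \<exists>w\<in>Z. r \<le> d w b"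
    and tail: "\<And>e. e > 0 \<Longrightarrow> \<exists>r. \<forall>x\<in>Z. \<forall>y\<in>Z. r \<le> d x b \<longrightarrow> r \<le> d y b \<longrightarrow> ddist x y < e"
  shows "completion_adds_one_point Z ddist"
proof -
  interpret D: Metric_space Z ddist
    using fin by (intro Metric_space_ddist val_less_top') auto
  obtain f :: "'a \<Rightarrow> 'a \<Rightarrow> real" and m where "mcomplete_of m" "f \<in> Z \<rightarrow> mspace m"
      "mtopology_of m closure_of f ` Z = mspace m"
      "\<And>x y. \<lbrakk>x \<in> Z; y \<in> Z\<rbrakk> \<Longrightarrow> mdist m (f x) (f y) = ddist x y"
    by (rule D.metric_completion) (rule that)
  then have m: "is_completion Z ddist m f"
    by (auto simp: is_completion_def)
  interpret Cm: Metric_space "mspace m" "mdist m" by (rule Metric_space_mspace_mdist)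
  have f: "f x \<in> mspace m" if "x \<in> Z" for x
    using m that by (auto simp: is_completion_def)
  have iso: "mdist m (f x) (f y) = ddist x y" if "x \<in> Z" "y \<in> Z" for x y
    using m that by (auto simp: is_completion_def)
  have "\<forall>n. \<exists>w. w \<in> Z \<and> real n \<le> d w b"
    using far by blast
  then obtain z where z: "\<And>n. z n \<in> Z" "\<And>n. real n \<le> d (z n) b"
    by metis
  have "Cm.MCauchy (\<lambda>n. f (z n))"
    unfolding Cm.MCauchy_def
  proof (intro conjI allI impI)
    fix e :: real assume "e > 0"
    then obtain r where r: "\<And>x y. x \<in> Z \<Longrightarrow> y \<in> Z \<Longrightarrow> r \<le> d x b \<Longrightarrow> r \<le> d y b \<Longrightarrow> ddist x y < e"
      using tail by blast
    obtain N where N: "r \<le> real N" using real_arch_simple by blast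
    have "r \<le> d (z n) b" if "N \<le> n" for n
      using z(2)[of n] N that by (meson of_nat_le_iff order_trans)
    then show "\<exists>N. \<forall>n n'. N \<le> n \<longrightarrow> N \<le> n' \<longrightarrow> mdist m (f (z n)) (f (z n')) < e"
      using r z(1) iso by (intro exI[of _ N]) auto
  qed (use z f in auto)
  then obtain p where p: "limitin Cm.mtopology (\<lambda>n. f (z n)) p sequentially"
    using m by (auto simp: is_completion_def mcomplete_of_def Cm.mcomplete_def)
  then have p': "p \<in> mspace m" "(\<lambda>n. mdist m (f (z n)) p) \<longlonglongrightarrow> 0"
    by (auto simp: Cm.limitin_metric_dist_null)
  have p_new: "p \<notin> f ` Z"
  proof
    assume "p \<in> f ` Z"
    then obtain x where x: "x \<in> Z" "p = f x" by auto
    \<comment> \<open>By the radial lower bound, points of radius at least \<open>t\<close> have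
      deformed distance at least \<open>\<rho> t\<close> from \<open>x\<close>, since the interval
      from \<open>d x b\<close> to \<open>t\<close> has length 1.\<close>
    define t where "t = d x b + 1"
    have t: "t > 0" by (simp add: t_def add_nonneg_pos)
    have "\<forall>\<^sub>F n in sequentially. ddist (z n) x < \<rho> t"
      using order_tendstoD(2)[OF p'(2), of "\<rho> t"] density_pos[OF t] iso z(1) x by simp
    moreover have "\<forall>\<^sub>F n in sequentially. t \<le> real n"
      using filterlim_real_sequentially by (simp add: filterlim_at_top)
    ultimately have "\<forall>\<^sub>F n in sequentially. ddist (z n) x < \<rho> t \<and> t \<le> real n"
      by (rule eventually_conj)
    then obtain n where n: "ddist (z n) x < \<rho> t" "t \<le> real n"
      using eventually_happens'[OF sequentially_bot] by blast
    have "ennreal (\<rho> t) = ennreal (\<rho> t * (t - d x b))"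
      by (simp add: t_def)
    also have "\<dots> \<le> \<mu> {d x b<..t}"
      using density t by (intro density_measure_Ioc_lower) (auto simp: t_def)
    also have "\<dots> \<le> \<mu> {d x b<..d (z n) b}"
      using n z(2)[of n] by (intro emeasure_mono) auto
    also have "\<dots> \<le> edist (z n) x"
      by (subst edist_commute) (rule density_measure_le_edist)
    also have "\<dots> < ennreal (\<rho> t)"
      using n(1) x(1) z(1) fin by (subst (asm) ddist_less_iff) (auto intro!: val_less_top')
    finally show False by simp
  qed
  have unique: "q = p" if q: "q \<in> mspace m" "q \<notin> f ` Z" for q
  proof (rule ccontr)
    assume "q \<noteq> p"
    \<comment> \<open>A third, because the path from \<open>q\<close> to \<open>p\<close> through
      \<open>f x\<close> and \<open>f y\<close> has three legs shorter than
      \<open>e\<close>.\<close>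
    define e where "e = mdist m q p / 3"
    have e: "e > 0"
      using \<open>q \<noteq> p\<close> q p' by (simp add: e_def)
    obtain r where r: "\<And>x y. x \<in> Z \<Longrightarrow> y \<in> Z \<Longrightarrow> r \<le> d x b \<Longrightarrow> r \<le> d y b \<Longrightarrow> ddist x y < e"
      using tail[OF e] by blast
    obtain x where x: "x \<in> Z" "r \<le> d x b" "mdist m q (f x) < e"
      using in_completion_far[OF complete fin m q e] by blast
    obtain y where y: "y \<in> Z" "r \<le> d y b" "mdist m p (f y) < e"
      using in_completion_far[OF complete fin m p'(1) p_new e] by blast
    have "mdist m q p \<le> mdist m q (f x) + mdist m (f x) p"
      "mdist m (f x) p \<le> mdist m (f x) (f y) + mdist m p (f y)"
      using q(1) p'(1) f x(1) y(1) by (auto intro: Cm.triangle Cm.triangle')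
    then show False
      using r[OF x(1) y(1) x(2) y(2)] x(3) y(3) iso[OF x(1) y(1)] by (simp add: e_def)
  qed
  have "\<exists>!p. p \<in> mspace m - f ` Z"
  proof (rule ex1I)
    show "p \<in> mspace m - f ` Z" using p' p_new by simp
    show "q = p" if "q \<in> mspace m - f ` Z" for q
      using that by (intro unique) simp_all
  qed
  with m show ?thesis
    unfolding completion_adds_one_point_def by (intro exI[of _ m] exI[of _ f] conjI)
qed

section \<open>Uniform perfectness as nonempty shells\<close>

lemma unif_perfect_large_scales_shells:
  assumes "unif_perfect_large_scales_at Z d b"
  obtains \<kappa> where "\<kappa> > 1" "\<And>r. r \<ge> 1 \<Longrightarrow> \<exists>w\<in>Z. r \<le> d w b \<and> d w b < \<kappa> * r"
proof -
  from assms obtain \<kappa> where \<kappa>: "\<kappa> > 1" "\<And>r. r \<ge> 1 \<Longrightarrow> mball b (\<kappa> * r) - mball b r \<noteq> {}"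
    unfolding unif_perfect_large_scales_at_def by blast
  have "\<exists>w\<in>Z. r \<le> d w b \<and> d w b < \<kappa> * r" if "r \<ge> 1" for r
  proof -
    have "mball b (\<kappa> * r) - mball b r \<noteq> {}"
      using that by (rule \<kappa>)
    then obtain w where "w \<in> mball b (\<kappa> * r)" "w \<notin> mball b r"
      by blast
    then show ?thesis using base commute[of b w] by (intro bexI[of _ w]) auto
  qed
  with \<kappa>(1) show thesis by (rule that)
qed

text \<open>The point \<open>z\<close> of radius at least \<open>r\<close> witnesses that the ball
  of radius \<open>r\<close> is not all of \<open>Z\<close>.\<close>

lemma unif_perfect_shells:
  assumes "unif_perfect_at Z d b"
  obtains \<kappa> where "\<kappa> > 1"
    "\<And>r z. z \<in> Z \<Longrightarrow> 0 < r \<Longrightarrow> r \<le> d z b \<Longrightarrow> \<exists>w\<in>Z. r \<le> d w b \<and> d w b < \<kappa> * r"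
proof -
  from assms obtain \<kappa> where \<kappa>: "\<kappa> > 1"
    "\<And>r. r > 0 \<Longrightarrow> mball b r \<noteq> Z \<Longrightarrow> mball b (\<kappa> * r) - mball b r \<noteq> {}"
    unfolding unif_perfect_at_def by blast
  have "\<exists>w\<in>Z. r \<le> d w b \<and> d w b < \<kappa> * r" if r: "z \<in> Z" "0 < r" "r \<le> d z b" for r z
  proof -
    have "z \<notin> mball b r" using r commute[of b z] by simp
    with r(1) have "mball b r \<noteq> Z" by blast
    then have "mball b (\<kappa> * r) - mball b r \<noteq> {}"
      by (rule \<kappa>(2)[OF r(2)])
    then obtain w where "w \<in> mball b (\<kappa> * r)" "w \<notin> mball b r"
      by blast
    then show ?thesis using base commute[of b w] by (intro bexI[of _ w]) auto
  qed
  with \<kappa>(1) show thesis by (rule that)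
qed

section \<open>Sphericalization\<close>

text \<open>A bound on the deformed distances from \<open>b\<close> bounds the integral by the
  radial lower bound. Conversely, a small tail of the integral makes distances far out small, which
  yields both the limit point and boundedness.\<close>

lemma sphericalization:
  assumes complete: mcomplete and perfect: "unif_perfect_large_scales_at Z d b"
    and fin: "density_val \<rho> 0 < top"
  shows "Metric_space.mbounded Z ddist Z \<and> completion_adds_one_point Z ddist
    \<longleftrightarrow> \<mu> {0<..} < top"
proof -
  interpret D: Metric_space Z ddist
    using fin by (intro Metric_space_ddist val_less_top') auto
  have val: "val x < top" for x using fin by (rule val_less_top')
  obtain \<kappa> where \<kappa>: "\<kappa> > 1" and shells: "\<And>r. r \<ge> 1 \<Longrightarrow> \<exists>w\<in>Z. r \<le> d w b \<and> d w b < \<kappa> * r"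
    using unif_perfect_large_scales_shells[OF perfect] by blast
  have far: "\<exists>w\<in>Z. r \<le> d w b" for r
    using shells[of "max r 1"] by force
  show ?thesis
  proof (intro iffI conjI)
    assume "D.mbounded Z \<and> completion_adds_one_point Z ddist"
    then obtain B where "\<forall>x\<in>Z. \<forall>y\<in>Z. ddist x y \<le> B"
      by (auto simp: D.mbounded_alt)
    then have B: "ddist x y \<le> max B 0" if "x \<in> Z" "y \<in> Z" for x y
      using that by (simp add: le_max_iff_disj)
    have "\<mu> {0<..} \<le> ennreal (max B 0)"
    proof (rule density_measure_Ioi_le)
      fix n
      obtain x where x: "x \<in> Z" "real n \<le> d x b" using far by blast
      have "\<mu> {0<..real n} \<le> \<mu> {d b b<..d x b}"
        using x base by (intro emeasure_mono) auto
      also have "\<dots> \<le> edist b x"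
        by (rule density_measure_le_edist)
      also have "\<dots> \<le> ennreal (max B 0)"
        using B[OF base x(1)] by (subst (asm) ddist_le_iff) (auto intro!: x base val)
      finally show "\<mu> {0<..real n} \<le> ennreal (max B 0)" .
    qed
    then show "\<mu> {0<..} < top" by (auto intro: le_less_trans)
  next
    assume finite: "\<mu> {0<..} < top"
    have tail: "\<exists>r. \<forall>x\<in>Z. \<forall>y\<in>Z. r \<le> d x b \<longrightarrow> r \<le> d y b \<longrightarrow> ddist x y < e" if e: "e > 0" for e
    proof -
      define C where "C = 4 * \<kappa> ^ 4 / (\<kappa> - 1)"
      have C: "C > 0" using \<kappa> by (simp add: C_def)
      obtain r where r: "0 \<le> r" "\<mu> {r<..} < ennreal (e / C)"
        using density_measure_tail[OF finite, of "ennreal (e / C)"] e C by auto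
      \<comment> \<open>The annulus estimate uses the measure from \<open>s / \<kappa>\<close> on,
        so \<open>s\<close> is enlarged by \<kappa> to stay in the small tail; adding 1 ensures
        \<open>1 \<le> s\<close>, the range where shells are known to be nonempty.\<close>
      define s where "s = \<kappa> * (r + 1)"
      have s: "1 \<le> s" "s / \<kappa> = r + 1"
        using \<kappa> r(1) mult_mono[of 1 \<kappa> 1 "r + 1"] by (auto simp: s_def)
      have "ddist x y < e" if xy: "x \<in> Z" "y \<in> Z" "s \<le> d x b" "s \<le> d y b" for x y
      proof -
        have "edist x y \<le> ennreal C * \<mu> {s / \<kappa><..max (d x b) (d y b)}"
          unfolding C_def using s xy by (intro edist_annulus_le \<kappa> shells) auto
        also have "\<dots> \<le> ennreal C * \<mu> {r<..}"
          using s by (intro mult_left_mono emeasure_mono) auto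
        also have "\<dots> < ennreal C * ennreal (e / C)"
          using C r by (intro ennreal_mult_strict_left_mono) auto
        also have "\<dots> = ennreal e"
          using C e by (simp flip: ennreal_mult)
        finally show ?thesis
          using xy val by (subst ddist_less_iff) auto
      qed
      then show ?thesis by blast
    qed
    show "completion_adds_one_point Z ddist"
      by (rule completion_adds_one_pointI[OF complete fin far tail])
    obtain r where r: "\<And>x y. x \<in> Z \<Longrightarrow> y \<in> Z \<Longrightarrow> r \<le> d x b \<Longrightarrow> r \<le> d y b \<Longrightarrow> ddist x y < 1"
      using tail[of 1] by auto
    obtain w where w: "w \<in> Z" "r \<le> d w b" using far by blast
    define k where "k = enn2real (density_val \<rho> 0)"
    have k: "val y \<le> ennreal k" for y
      using fin density_val_antimono[OF density, of 0 "d y b"] by (simp add: k_def)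
    have "ddist w x \<le> max 1 (2 * k * (d w b + r))" if x: "x \<in> Z" for x
    proof (cases "r \<le> d x b")
      case True
      then show ?thesis using r[OF w(1) x w(2)] by simp
    next
      case False
      have "ddist w x \<le> 2 * k * d w x"
        using w x by (intro ddist_le_dist k) (auto simp: k_def)
      also have "\<dots> \<le> 2 * k * (d w b + r)"
        using triangle'[OF w(1) base x] False by (intro mult_left_mono) (auto simp: k_def)
      finally show ?thesis by simp
    qed
    then show "D.mbounded Z"
      using w(1) unfolding D.mbounded_def by (intro exI[of _ w] exI subsetI) (simp add: D.in_mcball)
  qed
qed

section \<open>Flattening\<close>

text \<open>Makes \<open>b\<close> an accumulation point of \<open>Z\<close>. In the choice of
  \<open>r\<close>, the bound \<open>\<delta> / \<kappa>\<close> puts the shell inside the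
  \<delta>-ball, and \<open>d z0 b\<close> ensures that the shell is nonempty.\<close>

lemma unif_perfect_near:
  assumes perfect: "unif_perfect_at Z d b" and z0: "z0 \<in> Z" "z0 \<noteq> b" and \<delta>: "\<delta> > 0"
  shows "\<exists>w\<in>Z - {b}. d w b < \<delta>"
proof -
  obtain \<kappa> where \<kappa>: "\<kappa> > 1"
    and shells: "\<And>r z. z \<in> Z \<Longrightarrow> 0 < r \<Longrightarrow> r \<le> d z b \<Longrightarrow> \<exists>w\<in>Z. r \<le> d w b \<and> d w b < \<kappa> * r"
    using unif_perfect_shells[OF perfect] by blast
  define r where "r = min (\<delta> / \<kappa>) (d z0 b)"
  have "0 < r" "r \<le> d z0 b" using \<delta> \<kappa> z0 base by (auto simp: r_def)
  then obtain w where w: "w \<in> Z" "r \<le> d w b" "d w b < \<kappa> * r"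
    using shells[OF z0(1)] by blast
  have "\<kappa> * r \<le> \<kappa> * (\<delta> / \<kappa>)"
    using \<kappa> by (intro mult_left_mono) (auto simp: r_def)
  then have "d w b < \<delta>" using w(3) \<kappa> by simp
  moreover have "w \<noteq> b" using w(2) \<open>0 < r\<close> base by auto
  ultimately show ?thesis using w(1) by auto
qed

text \<open>Divergence moves \<open>b\<close> infinitely far away, so \<open>ddist\<close>-bounded
  sets keep a positive \<open>d\<close>-distance from \<open>b\<close>. A Cauchy sequence thus stays
  in an annulus, where the density is bounded above and below.\<close>

lemma flattening_unbounded_complete:
  assumes complete: mcomplete and bounded: "mbounded Z" and perfect: "unif_perfect_at Z d b"
    and z0: "z0 \<in> Z" "z0 \<noteq> b" and inf: "\<mu> {0<..1} = \<infinity>"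
  shows "\<not> Metric_space.mbounded (Z - {b}) ddist (Z - {b})"
    and "Metric_space.mcomplete (Z - {b}) ddist"
proof -
  interpret D: Metric_space "Z - {b}" ddist
    by (intro Metric_space_ddist val_less_top) auto
  have near: "\<exists>w\<in>Z - {b}. d w b < \<delta>" if "\<delta> > 0" for \<delta>
    using perfect z0 that by (rule unif_perfect_near)
  \<comment> \<open>Points within \<open>B\<close> of \<open>z\<close> and arbitrarily close to
    \<open>b\<close> would bound the integral from 0 to \<open>d z b\<close> by the radial lower
    bound.\<close>
  have escape: "\<exists>\<delta>>0. \<forall>x\<in>Z - {b}. ddist x z \<le> B \<longrightarrow> \<delta> \<le> d x b" if z: "z \<in> Z - {b}" for z B
  proof (rule ccontr)
    assume "\<not> ?thesis"
    then have close: "\<exists>x\<in>Z - {b}. ddist x z \<le> B \<and> d x b < \<delta>" if "\<delta> > 0" for \<delta>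
      using that by (meson not_le)
    have "\<mu> {0<..d z b} \<le> ennreal (max B 0)"
    proof (rule density_measure_Ioc_0_le)
      fix \<delta> :: real assume "\<delta> > 0"
      then obtain x where x: "x \<in> Z - {b}" "ddist x z \<le> B" "d x b < \<delta>"
        using close by blast
      have "\<mu> {\<delta><..d z b} \<le> \<mu> {d x b<..d z b}"
        using x(3) by (intro emeasure_mono) auto
      also have "\<dots> \<le> edist x z"
        by (rule density_measure_le_edist)
      also have "\<dots> \<le> ennreal (max B 0)"
        using x z val_less_top by (subst ddist_le_iff[symmetric]) auto
      finally show "\<mu> {\<delta><..d z b} \<le> ennreal (max B 0)" .
    qed
    then have "\<mu> {0<..d z b} < top" by (auto intro: le_less_trans)
    \<comment> \<open>If \<open>z\<close> has radius below 1, the stretch from there to 1 is still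
      missing; its density is at most \<open>val z\<close>.\<close>
    moreover have "\<mu> {d z b<..max (d z b) 1} < top"
    proof -
      have "\<mu> {d z b<..max (d z b) 1} \<le> val z * ennreal (max (d z b) 1 - d z b)"
        using density by (intro density_measure_Ioc_upper) auto
      also have "\<dots> < top"
        using val_less_top[OF z] by (simp add: ennreal_mult_less_top)
      finally show ?thesis .
    qed
    ultimately have "\<mu> {0<..1} < top"
      by (rule emeasure_less_top_cover) auto
    with inf show False by simp
  qed
  show "\<not> D.mbounded (Z - {b})"
  proof
    assume "D.mbounded (Z - {b})"
    then obtain B where B: "\<forall>x\<in>Z - {b}. \<forall>y\<in>Z - {b}. ddist x y \<le> B"
      by (auto simp: D.mbounded_alt)
    obtain \<delta> where "\<delta> > 0" "\<forall>x\<in>Z - {b}. ddist x z0 \<le> B \<longrightarrow> \<delta> \<le> d x b"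
      using escape[of z0 B] z0 by auto
    with near[of \<delta>] B z0 show False by force
  qed
  show D.mcomplete
    unfolding D.mcomplete_def
  proof (intro allI impI)
    fix \<sigma> assume \<sigma>: "D.MCauchy \<sigma>"
    then have ran: "\<sigma> n \<in> Z - {b}" for n by (auto simp: D.MCauchy_def)
    have "D.mbounded (range \<sigma>)" by (rule D.MCauchy_imp_mbounded[OF \<sigma>])
    then obtain B where B: "ddist (\<sigma> n) (\<sigma> 0) \<le> B" for n
      by (auto simp: D.mbounded_alt)
    obtain \<delta> where \<delta>: "\<delta> > 0" "\<And>n. \<delta> \<le> d (\<sigma> n) b"
      using escape[OF ran[of 0], of B] B ran by blast
    obtain R where R: "\<And>x. x \<in> Z \<Longrightarrow> d x b \<le> R"
      using bounded mbounded_iff_base by auto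
    have "\<exists>N. \<forall>m\<ge>N. \<forall>n\<ge>N. edist (\<sigma> m) (\<sigma> n) < ennreal e" if "e > 0" for e
    proof -
      have "\<exists>N. \<forall>m n. N \<le> m \<longrightarrow> N \<le> n \<longrightarrow> ddist (\<sigma> m) (\<sigma> n) < e"
        using \<sigma> that by (simp add: D.MCauchy_def)
      then obtain N where "\<And>m n. N \<le> m \<Longrightarrow> N \<le> n \<Longrightarrow> ddist (\<sigma> m) (\<sigma> n) < e"
        by blast
      then have "\<forall>m\<ge>N. \<forall>n\<ge>N. edist (\<sigma> m) (\<sigma> n) < ennreal e"
        using ran val_less_top by (auto simp flip: ddist_less_iff)
      then show ?thesis by blast
    qed
    then obtain x where x: "x \<in> Z" "(\<lambda>n. d (\<sigma> n) x) \<longlonglongrightarrow> 0"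
      using bounded_Cauchy_convergent[OF complete, of \<sigma> R] ran R by blast
    \<comment> \<open>The lower bound on the radii passes to the limit, which keeps \<open>x\<close>
      away from \<open>b\<close>.\<close>
    have "\<delta> - d (\<sigma> n) x \<le> d x b" for n
      using triangle[of "\<sigma> n" x b] ran[of n] x(1) base \<delta>(2)[of n] by auto
    moreover have "(\<lambda>n. \<delta> - d (\<sigma> n) x) \<longlonglongrightarrow> \<delta> - 0"
      by (intro tendsto_intros x)
    ultimately have \<delta>x: "\<delta> \<le> d x b"
      using LIMSEQ_le_const2[of "\<lambda>n. \<delta> - d (\<sigma> n) x" \<delta> "d x b"] by simp
    with \<delta>(1) base have xM: "x \<in> Z - {b}" using x(1) by auto
    have val: "val y \<le> ennreal (\<rho> \<delta>)" if "\<delta> \<le> d y b" for y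
      using density_val_antimono[OF density _ that] \<delta>(1) by (simp add: density_val_pos)
    have "(\<lambda>n. ddist (\<sigma> n) x) \<longlonglongrightarrow> 0"
    proof (rule tendsto_sandwich[OF _ _ tendsto_const])
      show "\<forall>\<^sub>F n in sequentially. ddist (\<sigma> n) x \<le> 2 * \<rho> \<delta> * d (\<sigma> n) x"
        using ran x(1) \<delta>(2) \<delta>x density_pos[OF \<delta>(1)]
        by (intro always_eventually allI ddist_le_dist val) auto
      show "(\<lambda>n. 2 * \<rho> \<delta> * d (\<sigma> n) x) \<longlonglongrightarrow> 0"
        by (rule tendsto_mult_right_zero[OF x(2)])
    qed simp
    then show "\<exists>x. limitin D.mtopology \<sigma> x sequentially"
      using xM ran by (intro exI[of _ x]) (simp add: D.limitin_metric_dist_null)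
  qed
qed

text \<open>A sequence converging to \<open>b\<close> for \<open>d\<close> is Cauchy for
  \<open>ddist\<close> by the annulus estimate and the smallness of the integral near 0. A limit in
  \<open>Z - {b}\<close> is excluded by the local lower bound.\<close>

lemma flattening_incomplete:
  assumes perfect: "unif_perfect_at Z d b"
    and z0: "z0 \<in> Z" "z0 \<noteq> b" and finite: "\<mu> {0<..1} < top"
  shows "\<not> Metric_space.mcomplete (Z - {b}) ddist"
proof
  interpret D: Metric_space "Z - {b}" ddist
    by (intro Metric_space_ddist val_less_top) auto
  assume complete: D.mcomplete
  obtain \<kappa> where \<kappa>: "\<kappa> > 1"
    and shells: "\<And>r z. z \<in> Z \<Longrightarrow> 0 < r \<Longrightarrow> r \<le> d z b \<Longrightarrow> \<exists>w\<in>Z. r \<le> d w b \<and> d w b < \<kappa> * r"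
    using unif_perfect_shells[OF perfect] by blast
  have "\<exists>w\<in>Z - {b}. d w b < 1 / real (Suc n)" for n
    using perfect z0 by (rule unif_perfect_near) simp
  then obtain z where z: "\<And>n. z n \<in> Z - {b}" "\<And>n. d (z n) b < 1 / real (Suc n)"
    by metis
  have small: "\<forall>\<^sub>F n in sequentially. d (z n) b < \<delta>" if "\<delta> > 0" for \<delta>
  proof -
    have "\<forall>\<^sub>F n in sequentially. 1 / real (Suc n) < \<delta>"
      using order_tendstoD(2)[OF LIMSEQ_Suc[OF lim_1_over_n] that] .
    then show ?thesis
      by (rule eventually_mono) (use z(2) in \<open>auto intro: less_trans\<close>)
  qed
  have "D.MCauchy z"
    unfolding D.MCauchy_def
  proof (intro conjI allI impI)
    fix e :: real assume e: "e > 0"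
    define C where "C = 4 * \<kappa> ^ 4 / (\<kappa> - 1)"
    have C: "C > 0" using \<kappa> by (simp add: C_def)
    obtain r where r: "0 < r" "r \<le> 1" "\<mu> {0<..r} < ennreal (e / C)"
      using density_measure_head[OF finite, of "ennreal (e / C)"] e C by auto
    obtain N where N: "\<And>n. n \<ge> N \<Longrightarrow> d (z n) b < r"
      using small[OF r(1)] by (auto simp: eventually_sequentially)
    have "ddist (z m) (z n) < e" if mn: "N \<le> m" "N \<le> n" for m n
    proof -
      define s where "s = min (d (z m) b) (d (z n) b)"
      define R where "R = max (d (z m) b) (d (z n) b)"
      have s: "s > 0" using z(1)[of m] z(1)[of n] base by (auto simp: s_def)
      have R: "R < r" using N mn by (simp add: R_def)
      \<comment> \<open>The one of \<open>z m\<close> and \<open>z n\<close> with larger radius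
        witnesses the shells for all radii up to \<open>R\<close>.\<close>
      have "\<exists>w\<in>Z. u \<le> d w b \<and> d w b < \<kappa> * u" if "s \<le> u" "u \<le> R" for u
        using shells[of "z m" u] shells[of "z n" u] z(1) s that by (auto simp: R_def max_def split: if_splits)
      then have "edist (z m) (z n) \<le> ennreal C * \<mu> {s / \<kappa><..R}"
        unfolding C_def using s z(1) by (intro edist_annulus_le \<kappa>) (auto simp: s_def R_def)
      also have "\<dots> \<le> ennreal C * \<mu> {0<..r}"
      proof (intro mult_left_mono emeasure_mono)
        have "0 < s / \<kappa>" using s \<kappa> by simp
        with R show "{s / \<kappa><..R} \<subseteq> {0<..r}" by auto
      qed auto
      also have "\<dots> < ennreal C * ennreal (e / C)"
        using C r by (intro ennreal_mult_strict_left_mono) auto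
      also have "\<dots> = ennreal e"
        using C e by (simp flip: ennreal_mult)
      finally show ?thesis
        using z(1) val_less_top by (subst ddist_less_iff) auto
    qed
    then show "\<exists>N. \<forall>n n'. N \<le> n \<longrightarrow> N \<le> n' \<longrightarrow> ddist (z n) (z n') < e"
      by blast
  qed (use z(1) in auto)
  then obtain x where "limitin D.mtopology z x sequentially"
    using complete by (auto simp: D.mcomplete_def)
  then have x: "x \<in> Z - {b}" "(\<lambda>n. ddist (z n) x) \<longlonglongrightarrow> 0"
    by (auto simp: D.limitin_metric_dist_null)
  define t where "t = d x b"
  have t: "t > 0" using x base by (simp add: t_def)
  \<comment> \<open>The value of the local lower bound at \<open>x\<close> with radius
    \<open>2 * t\<close>: the cutoff is \<open>t\<close>, and points of radius below
    \<open>t / 2\<close> are at distance at least \<open>t / 2\<close> from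
    \<open>x\<close>.\<close>
  define c where "c = \<rho> (2 * t) * (t / 2)"
  have c: "c > 0" using density_pos[of "2 * t"] t by (simp add: c_def)
  have "\<forall>\<^sub>F n in sequentially. ddist (z n) x < c \<and> d (z n) b < t / 2"
    using order_tendstoD(2)[OF x(2) c] small[of "t / 2"] t by (intro eventually_conj) auto
  then obtain n where n: "ddist (z n) x < c" "d (z n) b < t / 2"
    using eventually_happens'[OF sequentially_bot] by blast
  have "t / 2 \<le> min (d x (z n)) (2 * t - t)"
    using triangle[of x "z n" b] x(1) z(1)[of n] base n(2) t by (auto simp: t_def)
  then have "c \<le> \<rho> (2 * t) * min (d x (z n)) (2 * t - t)"
    unfolding c_def using density_pos[of "2 * t"] t by (intro mult_left_mono) auto
  then have "ennreal c \<le> ennreal (\<rho> (2 * t) * min (d x (z n)) (2 * t - d x b))"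
    by (intro ennreal_leI) (simp add: t_def)
  also have "\<dots> \<le> edist x (z n)"
    using x(1) t by (intro edist_lower_local) (auto simp: t_def)
  also have "\<dots> < ennreal c"
    using n(1) x(1) z(1) val_less_top by (subst edist_commute, subst ddist_less_iff[symmetric]) auto
  finally show False by simp
qed

end

section \<open>The two integral criteria\<close>

theorem proposition1p2:
  fixes Z :: "'a set" and d :: "'a \<Rightarrow> 'a \<Rightarrow> real" and b :: 'a and \<rho> :: "real \<Rightarrow> real"
  assumes "Metric_space Z d"
    and "Metric_space.mcomplete Z d"
    and "mdiam Z d > 0"
    and "b \<in> Z"
    and "metric_density \<rho>"
  shows "(\<not> Metric_space.mbounded Z d Z \<and> unif_perfect_large_scales_at Z d b \<and>
            density_val \<rho> 0 < \<infinity> \<longrightarrow>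
          (Metric_space.mbounded Z (deformed_dist Z d b \<rho>) Z \<and>
             completion_adds_one_point Z (deformed_dist Z d b \<rho>)
           \<longleftrightarrow> (\<integral>\<^sup>+t\<in>{1..}. ennreal (\<rho> t) \<partial>lborel) < \<infinity>))
       \<and> (Metric_space.mbounded Z d Z \<and> unif_perfect_at Z d b \<longrightarrow>
          (\<not> Metric_space.mbounded (Z - {b}) (deformed_dist Z d b \<rho>) (Z - {b}) \<and>
             Metric_space.mcomplete (Z - {b}) (deformed_dist Z d b \<rho>)
           \<longleftrightarrow> (\<integral>\<^sup>+t\<in>{0<..1}. ennreal (\<rho> t) \<partial>lborel) = \<infinity>))"
proof -
  interpret density_space Z d b \<rho>
    using assms by (simp add: density_space_def density_space_axioms_def)
  have tail: "(\<integral>\<^sup>+t\<in>{1..}. ennreal (\<rho> t) \<partial>lborel) = \<mu> {1..}"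
    using assms(5) by (subst emeasure_density_measure) auto
  have head: "(\<integral>\<^sup>+t\<in>{0<..1}. ennreal (\<rho> t) \<partial>lborel) = \<mu> {0<..1}"
    using assms(5) by (subst emeasure_density_measure) auto
  \<comment> \<open>Sphericalization is stated with the integral from 0; the part up to 1 is finite
    because the density is bounded by its finite value at 0.\<close>
  have tail_iff: "\<mu> {0<..} < \<infinity> \<longleftrightarrow> \<mu> {1..} < \<infinity>" if fin: "density_val \<rho> 0 < \<infinity>"
  proof
    assume "\<mu> {0<..} < \<infinity>"
    moreover have "\<mu> {1..} \<le> \<mu> {0<..}" by (intro emeasure_mono) auto
    ultimately show "\<mu> {1..} < \<infinity>" by (rule le_less_trans[rotated])
  next
    assume "\<mu> {1..} < \<infinity>"
    moreover have "\<mu> {0<..1} < \<infinity>"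
      using density_measure_Ioc_upper[OF assms(5), of 0 1] fin by (auto intro: le_less_trans)
    ultimately have "\<mu> {0<..1} < top" "\<mu> {1..} < top"
      by simp_all
    then have "\<mu> {0<..} < top"
      by (rule emeasure_less_top_cover) auto
    then show "\<mu> {0<..} < \<infinity>" by simp
  qed
  \<comment> \<open>A space of positive diameter has a point other than \<open>b\<close>.\<close>
  obtain z0 where z0: "z0 \<in> Z" "z0 \<noteq> b"
  proof (rule ccontr)
    assume "\<not> thesis"
    with that have "Z \<subseteq> {b}" by auto
    then have "ennreal (d x y) = 0" if "x \<in> Z" "y \<in> Z" for x y
      using that assms(4) by auto
    then have "mdiam Z d \<le> 0"
      unfolding mdiam_def by (intro SUP_least) auto
    with assms(3) show False by simp
  qed
  have head_inf: "\<mu> {0<..1} = \<infinity>"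
    if "unif_perfect_at Z d b" "Metric_space.mcomplete (Z - {b}) ddist"
    using flattening_incomplete[OF that(1) z0] that(2)
    by (metis infinity_ennreal_def top.not_eq_extremum)
  show ?thesis
    unfolding tail head
    using sphericalization[OF assms(2)] tail_iff
      flattening_unbounded_complete[OF assms(2) _ _ z0] head_inf
    by auto
qed

end
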